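(* Consider an arbitrary 2-dimensional array transmitter--receiver pair with $M_t$ and $M_r$ antennas, respectively, whose topologies (antenna positions) are fixed and known a priori, and let $\boldsymbol{\Delta}=\mathbf{X}_r\mathbf{D}\mathbf{X}_t^T\in\mathbb{C}^{M_r\times M_t}$ be the associated data matrix with $K$ targets (as defined in the context). Assume that the target angles $\theta_0,\dots,\theta_{K-1}$ are almost surely pairwise distinct and that $(\theta_i,\theta_j)\in\mathcal{A}$ for all $i,j\in\{0,\dots,K-1\}$ with $i\neq j$, where $$\mathcal{A}\subseteq\mathbb{R}^2\setminus\{(x,y)\in\mathbb{R}^2: x=y\}$$ is a nonempty nominal set of admissible angle pairs. For $i\in\{t,r\}$ let $$\varphi_i(x,y)=\sum_{m=0}^{M_i-1}\exp\!\left(j2\pi\,\mathbf{r}_i^T(m)\left(\mathcal{T}(x)-\mathcal{T}(y)\right)\right),\qquad \beta_i=\sup_{(x,y)\in\mathcal{A}}|\varphi_i(x,y)|^2\in[0,M_i^2).$$ Then, for any $M_t$ and $M_r$, as long as $$K\le\min_{i\in\{t,r\}}\frac{M_i}{\sqrt{\beta_i}}$$ (with the convention $M_i/0=+\infty$), the matrix $\boldsymbol{\Delta}$ obeys, with probability $1$, the assumptions $\mathbf{A0}$ and $\mathbf{A1}$ (defined in the context) with $$\mu_0=\max_{i\in\{t,r\}}\frac{M_i}{M_i-(K-1)\sqrt{\beta_i}},\qquad\mu_1=\max_{i\in\{t,r\}}\frac{M_i\sqrt K}{M_i-(K-1)\sqrt{\beta_i}}.$$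
   Context: Setting. $\lambda>0$ is the carrier wavelength. For $i\in\{t,r\}$ (transmit, receive) the antenna coordinates of the array are $[x_l^{i}\ y_l^{i}]^T\in\mathbb{R}^2$, $l=0,\dots,M_i-1$, and $\mathbf{r}_i(l)=\frac1\lambda[x_l^{i}\ y_l^{i}]^T$. For $x\in\mathbb{R}$, $\mathcal{T}(x)=[\cos x\ \ \sin x]^T$. The target angles $\theta_0,\dots,\theta_{K-1}$ are real (possibly random). $\mathbf{X}_i\in\mathbb{C}^{M_i\times K}$ has entries $e^{j2\pi\mathbf{r}_i^T(l)\mathcal{T}(\theta_k)}$, $0\le l\le M_i-1$, $0\le k\le K-1$ ($j=\sqrt{-1}$). $\mathbf{D}\in\mathbb{C}^{K\times K}$ is an arbitrary diagonal matrix with all diagonal entries nonzero. That $\beta_i<M_i^2$ is part of the setting. Coherence. For an $r$-dimensional subspace $U\subseteq\mathbb{C}^N$ with orthogonal projection $\mathbf{P}_U$ and standard basis $\mathbf{e}_1,\dots,\mathbf{e}_N$, the coherence is $\mu(U)=\frac{N}{r}\max_{1\le i\le N}\|\mathbf{P}_U\mathbf{e}_i\|_2^2\in[1,N/r]$. For a rank-$r$ matrix $\mathbf{M}\in\mathbb{C}^{N_1\times N_2}$ with compact SVD $\mathbf{M}=\sum_{i=1}^r\sigma_i\mathbf{u}_i\mathbf{v}_i^H$, put $U=\mathrm{span}\{\mathbf{u}_i\}$, $V=\mathrm{span}\{\mathbf{v}_i\}$. $\mathbf{M}$ obeys $\mathbf{A0}$ with $\mu_0>0$ if $\max\{\mu(U),\mu(V)\}\le\mu_0$;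 $\mathbf{A1}$ with $\mu_1>0$ if $\left\|\sum_{i=1}^r\mathbf{u}_i\mathbf{v}_i^H\right\|_\infty\le\mu_1\sqrt{r/(N_1N_2)}$, where $\|\cdot\|_\infty$ is the largest absolute value of an entry. *)

theory Defs
  imports "HOL-Probability.Probability" "Jordan_Normal_Form.DL_Rank"
    "Jordan_Normal_Form.Schur_Decomposition"
begin

text \<open>Vectors and matrices are those of theory \<open>Matrix\<close>: dimensions are values and indices
  start at 0. The clashing notation for type-indexed vectors is switched off.\<close>

no_notation vec_nth (infixl \<open>$\<close> 90)
no_notation inner (infix \<open>\<bullet>\<close> 70)

text \<open>Array geometry. The plane is \<^typ>\<open>real \<times> real\<close> with its library inner product; an array
  is given by its coordinates \<open>pos 0, \<dots>, pos (M - 1)\<close>.\<close>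

definition direction :: "real \<Rightarrow> real \<times> real" where
  "direction x = (cos x, sin x)"

definition normalized_pos :: "real \<Rightarrow> (nat \<Rightarrow> real \<times> real) \<Rightarrow> nat \<Rightarrow> real \<times> real" where
  "normalized_pos lam pos l = (1 / lam) *\<^sub>R pos l"

definition steering_matrix ::
    "real \<Rightarrow> (nat \<Rightarrow> real \<times> real) \<Rightarrow> nat \<Rightarrow> nat \<Rightarrow> (nat \<Rightarrow> real) \<Rightarrow> complex Matrix.mat" where
  "steering_matrix lam pos M K theta =
     Matrix.mat M K (\<lambda>(l, k).
       exp (\<i> * of_real (2 * pi * inner (normalized_pos lam pos l) (direction (theta k)))))"

definition data_matrix ::
    "complex Matrix.mat \<Rightarrow> complex Matrix.mat \<Rightarrow> complex Matrix.mat \<Rightarrow> complex Matrix.mat" where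
  "data_matrix Xr D Xt = Xr * D * transpose_mat Xt"

definition array_phi ::
    "real \<Rightarrow> (nat \<Rightarrow> real \<times> real) \<Rightarrow> nat \<Rightarrow> real \<Rightarrow> real \<Rightarrow> complex" where
  "array_phi lam pos M x y =
     (\<Sum>m<M. exp (\<i> * of_real (2 * pi * inner (normalized_pos lam pos m) (direction x - direction y))))"

definition array_beta ::
    "real \<Rightarrow> (nat \<Rightarrow> real \<times> real) \<Rightarrow> nat \<Rightarrow> (real \<times> real) set \<Rightarrow> real" where
  "array_beta lam pos M A = (SUP (x, y)\<in>A. (cmod (array_phi lam pos M x y))\<^sup>2)"

text \<open>Subspaces of \<open>\<complex>\<^sup>N\<close>. Here \<open>x \<bullet>c u\<close> is the Hermitian product, conjugating \<open>u\<close>.\<close>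

definition cspan :: "nat \<Rightarrow> complex Matrix.vec set \<Rightarrow> complex Matrix.vec set" where
  "cspan N S = LinearCombinations.module.span class_ring (module_vec TYPE(complex) N) S"

definition cdim :: "nat \<Rightarrow> complex Matrix.vec set \<Rightarrow> nat" where
  "cdim N U = vectorspace.dim class_ring ((module_vec TYPE(complex) N)\<lparr>carrier := U\<rparr>)"

definition orth_proj :: "complex Matrix.vec set \<Rightarrow> complex Matrix.vec \<Rightarrow> complex Matrix.vec" where
  "orth_proj U x = (THE p. p \<in> U \<and> (\<forall>u\<in>U. (x - p) \<bullet>c u = 0))"

definition sq_norm2 :: "complex Matrix.vec \<Rightarrow> real" where
  "sq_norm2 v = (\<Sum>i<dim_vec v. (cmod (v $ i))\<^sup>2)"

definition coherence :: "nat \<Rightarrow> complex Matrix.vec set \<Rightarrow> real" where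
  "coherence N U = real N / real (cdim N U) *
     Max ((\<lambda>i. sq_norm2 (orth_proj U (unit_vec N i))) ` {..<N})"

text \<open>\<open>compact_svd A r s u v\<close>: \<open>A\<close> has rank \<open>r\<close> and equals \<open>\<Sum>i<r. s i \<cdot> u i \<cdot> (v i)\<^sup>H\<close>, with
  positive \<open>s i\<close> and orthonormal families \<open>u\<close>, \<open>v\<close>.\<close>

definition outer_sum ::
    "nat \<Rightarrow> nat \<Rightarrow> nat \<Rightarrow> (nat \<Rightarrow> real) \<Rightarrow> (nat \<Rightarrow> complex Matrix.vec) \<Rightarrow> (nat \<Rightarrow> complex Matrix.vec)
      \<Rightarrow> complex Matrix.mat" where
  "outer_sum N1 N2 r s u v =
     Matrix.mat N1 N2 (\<lambda>(a, b). \<Sum>i<r. of_real (s i) * (u i $ a) * cnj (v i $ b))"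

definition orthonormal_family :: "nat \<Rightarrow> nat \<Rightarrow> (nat \<Rightarrow> complex Matrix.vec) \<Rightarrow> bool" where
  "orthonormal_family N r u \<longleftrightarrow>
     (\<forall>i<r. u i \<in> carrier_vec N) \<and> (\<forall>i<r. \<forall>j<r. u i \<bullet>c u j = (if i = j then 1 else 0))"

definition compact_svd ::
    "complex Matrix.mat \<Rightarrow> nat \<Rightarrow> (nat \<Rightarrow> real) \<Rightarrow> (nat \<Rightarrow> complex Matrix.vec)
      \<Rightarrow> (nat \<Rightarrow> complex Matrix.vec) \<Rightarrow> bool" where
  "compact_svd A r s u v \<longleftrightarrow>
     r = vec_space.rank (dim_row A) A \<and>
     (\<forall>i<r. 0 < s i) \<and>
     orthonormal_family (dim_row A) r u \<and>
     orthonormal_family (dim_col A) r v \<and>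
     A = outer_sum (dim_row A) (dim_col A) r s u v"

definition max_entry_norm :: "complex Matrix.mat \<Rightarrow> real" where
  "max_entry_norm A = Max ((\<lambda>(a, b). cmod (A $$ (a, b))) ` ({..<dim_row A} \<times> {..<dim_col A}))"

text \<open>A compact SVD is not unique, although the spans of the \<open>u i\<close> and of the \<open>v i\<close> and the
  sum of the \<open>u i \<cdot> (v i)\<^sup>H\<close> are. Both assumptions below therefore ask that a compact SVD exists
  and that the bound holds for each of them, so they neither hold vacuously nor depend on a choice.\<close>

definition obeys_A0 :: "complex Matrix.mat \<Rightarrow> real \<Rightarrow> bool" where
  "obeys_A0 A mu0 \<longleftrightarrow> 0 < mu0 \<and>
     (\<exists>r s u v. compact_svd A r s u v) \<and>
     (\<forall>r s u v. compact_svd A r s u v \<longrightarrow>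
        max (coherence (dim_row A) (cspan (dim_row A) (u ` {..<r})))
            (coherence (dim_col A) (cspan (dim_col A) (v ` {..<r}))) \<le> mu0)"

definition obeys_A1 :: "complex Matrix.mat \<Rightarrow> real \<Rightarrow> bool" where
  "obeys_A1 A mu1 \<longleftrightarrow> 0 < mu1 \<and>
     (\<exists>r s u v. compact_svd A r s u v) \<and>
     (\<forall>r s u v. compact_svd A r s u v \<longrightarrow>
        max_entry_norm (outer_sum (dim_row A) (dim_col A) r (\<lambda>_. 1) u v)
          \<le> mu1 * sqrt (real r / (real (dim_row A) * real (dim_col A))))"

end

theory Submission
  imports Defs
begin

text \<open>The Gram matrices of \<open>X\<^sub>r\<close> and of the conjugate of \<open>X\<^sub>t\<close> have diagonal entries \<open>M\<^sub>i\<close> and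
  off-diagonal entries of modulus at most \<open>\<surd>\<beta>\<^sub>i\<close>, so by diagonal dominance
  \<open>\<parallel>X c\<parallel>\<^sup>2 \<ge> (M\<^sub>i - (K - 1) \<surd>\<beta>\<^sub>i) \<parallel>c\<parallel>\<^sup>2\<close> with a positive constant. In particular \<open>\<Delta>\<close> has rank at
  least \<open>K\<close>. Its left singular vectors lie in the range of \<open>X\<^sub>r\<close>; writing the projection of
  \<open>e\<^sub>a\<close> onto their span as \<open>X\<^sub>r c\<close>, its squared norm equals its \<open>a\<close>-th entry, which is at most
  \<open>\<surd>K \<parallel>c\<parallel>\<close> since the entries of \<open>X\<^sub>r\<close> are unimodular. This gives
  \<open>\<parallel>P\<^sub>U e\<^sub>a\<parallel>\<^sup>2 \<le> K / (M\<^sub>r - (K - 1) \<surd>\<beta>\<^sub>r)\<close>, and the same argument applies to the right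
  singular vectors and the conjugate of \<open>X\<^sub>t\<close>. Both bounds follow, the second by Cauchy-Schwarz.\<close>

subsection \<open>Orthonormal families and coherence\<close>

lemma wide_system_kernel:
  fixes f :: "nat \<Rightarrow> nat \<Rightarrow> complex"
  assumes "r < n"
  obtains c where "\<And>i. i < r \<Longrightarrow> (\<Sum>k<n. f i k * c k) = 0" "\<exists>k<n. c k \<noteq> 0"
proof -
  define Q where "Q = Matrix.mat n n (\<lambda>(i, k). if i < r then f i k else 0)"
  have Q: "Q \<in> carrier_mat n n" by (simp add: Q_def)
  have "transpose_mat Q *\<^sub>v unit_vec n r = 0\<^sub>v n"
    using assms by (intro eq_vecI) (auto simp: Q_def scalar_prod_def unit_vec_def if_distrib cong: if_cong)
  moreover have "unit_vec n r \<noteq> (0\<^sub>v n :: complex Matrix.vec)" using assms by simp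
  ultimately have "Determinant.det (transpose_mat Q) = 0"
    using Q by (subst det_0_iff_vec_prod_zero_field[of _ n]) (auto intro!: exI[of _ "unit_vec n r"])
  then have "Determinant.det Q = 0" using Q by (simp add: det_transpose)
  then obtain v where v: "v \<in> carrier_vec n" "v \<noteq> 0\<^sub>v n" "Q *\<^sub>v v = 0\<^sub>v n"
    using Q by (auto simp: det_0_iff_vec_prod_zero_field[of _ n])
  show thesis
  proof
    fix i assume i: "i < r"
    have "(Q *\<^sub>v v) $ i = 0" using v i assms by simp
    then show "(\<Sum>k<n. f i k * v $ k) = 0"
      using i assms v(1) by (simp add: Q_def scalar_prod_def atLeast0LessThan)
  next
    show "\<exists>k<n. v $ k \<noteq> 0"
    proof (rule ccontr)
      assume "\<not> ?thesis"
      then have "v = 0\<^sub>v n" using v(1) by (intro eq_vecI) auto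
      with v(2) show False by simp
    qed
  qed
qed

lemma rank_injective:
  fixes A :: "complex Matrix.mat"
  assumes A: "A \<in> carrier_mat n r"
    and inj: "\<And>x. x \<in> carrier_vec r \<Longrightarrow> A *\<^sub>v x = 0\<^sub>v n \<Longrightarrow> x = 0\<^sub>v r"
  shows "vec_space.rank n A = r"
proof -
  interpret vec_space "TYPE(complex)" n .
  have dist: "distinct (cols A)"
  proof (rule ccontr)
    assume "\<not> distinct (cols A)"
    then obtain i j where ij: "i < r" "j < r" "i \<noteq> j" "col A i = col A j"
      using A by (auto simp: distinct_conv_nth)
    have ev: "A *\<^sub>v unit_vec r k = col A k" if "k < r" for k
      using that A by (intro eq_vecI) (auto simp: scalar_prod_right_unit)
    have "A *\<^sub>v (unit_vec r i - unit_vec r j) = A *\<^sub>v unit_vec r i - A *\<^sub>v unit_vec r j"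
      using A by (intro mult_minus_distrib_mat_vec) auto
    also have "\<dots> = 0\<^sub>v n" using ij A by (intro eq_vecI) (auto simp: ev)
    finally have "unit_vec r i - unit_vec r j = (0\<^sub>v r :: complex Matrix.vec)" by (intro inj) simp_all
    from arg_cong[OF this, of "\<lambda>x. x $ i"] show False using ij by simp
  qed
  have "lin_indpt (set (cols A))"
    using lin_depE[OF A _ dist] inj by metis
  then show ?thesis by (rule lin_indpt_full_rank[OF A dist])
qed

definition family_mat :: "nat \<Rightarrow> nat \<Rightarrow> (nat \<Rightarrow> complex Matrix.vec) \<Rightarrow> complex Matrix.mat" where
  "family_mat n r u = Matrix.mat n r (\<lambda>(a, i). u i $ a)"

lemma family_mat_mult:
  assumes "x \<in> carrier_vec r"
  shows "family_mat n r u *\<^sub>v x = Matrix.vec n (\<lambda>a. \<Sum>i<r. u i $ a * x $ i)"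
  using assms by (intro eq_vecI) (auto simp: family_mat_def scalar_prod_def atLeast0LessThan)

lemma orthonormal_familyD:
  assumes "orthonormal_family n r u" "i < r" "j < r"
  shows "(\<Sum>a<n. u i $ a * cnj (u j $ a)) = (if i = j then 1 else 0)"
proof -
  have "u i \<in> carrier_vec n" "u j \<in> carrier_vec n" "u i \<bullet>c u j = (if i = j then 1 else 0)"
    using assms unfolding orthonormal_family_def by blast+
  then show ?thesis by (simp add: scalar_prod_def atLeast0LessThan)
qed

lemma orthonormal_familyI:
  assumes "\<And>i. i < r \<Longrightarrow> u i \<in> carrier_vec n"
    "\<And>i j. i < r \<Longrightarrow> j < r \<Longrightarrow> (\<Sum>a<n. u i $ a * cnj (u j $ a)) = (if i = j then 1 else 0)"
  shows "orthonormal_family n r u"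
  unfolding orthonormal_family_def
proof (intro conjI allI impI)
  fix i j assume ij: "i < r" "j < r"
  have "dim_vec (u j) = n" using assms(1)[OF ij(2)] by simp
  then show "u i \<bullet>c u j = (if i = j then 1 else 0)"
    using assms(2)[OF ij] by (simp add: scalar_prod_def atLeast0LessThan)
qed (rule assms(1))

lemma orthonormal_coefficient:
  assumes "orthonormal_family n r u" "j < r"
  shows "(\<Sum>a<n. (\<Sum>i<r. u i $ a * c i) * cnj (u j $ a)) = c j"
proof -
  have "(\<Sum>a<n. (\<Sum>i<r. u i $ a * c i) * cnj (u j $ a)) = (\<Sum>a<n. \<Sum>i<r. c i * (u i $ a * cnj (u j $ a)))"
    by (simp add: sum_distrib_left sum_distrib_right mult.assoc mult.left_commute[of "c _"])
  also have "\<dots> = (\<Sum>i<r. c i * (\<Sum>a<n. u i $ a * cnj (u j $ a)))"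
    by (subst sum.swap) (simp add: sum_distrib_left)
  also have "\<dots> = (\<Sum>i<r. c i * (if i = j then 1 else 0))"
    using assms by (intro sum.cong) (auto simp: orthonormal_familyD)
  also have "\<dots> = c j" using assms(2) by (simp add: if_distrib cong: if_cong)
  finally show ?thesis .
qed

lemma orthonormal_norm:
  assumes "orthonormal_family n r u"
  shows "(\<Sum>a<n. (cmod (\<Sum>i<r. u i $ a * c i))\<^sup>2) = (\<Sum>i<r. (cmod (c i))\<^sup>2)"
proof -
  have "complex_of_real (\<Sum>a<n. (cmod (\<Sum>i<r. u i $ a * c i))\<^sup>2)
      = (\<Sum>a<n. (\<Sum>i<r. u i $ a * c i) * cnj (\<Sum>j<r. u j $ a * c j))"
    by (simp only: of_real_sum complex_norm_square)
  also have "\<dots> = (\<Sum>a<n. \<Sum>j<r. cnj (c j) * ((\<Sum>i<r. u i $ a * c i) * cnj (u j $ a)))"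
    by (simp add: sum_distrib_left mult_ac)
  also have "\<dots> = (\<Sum>j<r. cnj (c j) * (\<Sum>a<n. (\<Sum>i<r. u i $ a * c i) * cnj (u j $ a)))"
    by (subst sum.swap) (simp add: sum_distrib_left)
  also have "\<dots> = (\<Sum>j<r. cnj (c j) * c j)"
    using assms by (simp add: orthonormal_coefficient)
  also have "\<dots> = complex_of_real (\<Sum>i<r. (cmod (c i))\<^sup>2)"
    by (simp only: of_real_sum complex_norm_square mult.commute)
  finally show ?thesis by (simp only: of_real_eq_iff)
qed

lemma orthonormal_family_size:
  assumes "orthonormal_family n r u"
  shows "r \<le> n"
proof (rule ccontr)
  assume "\<not> r \<le> n"
  then obtain c where c: "\<And>a. a < n \<Longrightarrow> (\<Sum>i<r. u i $ a * c i) = 0" "\<exists>i<r. c i \<noteq> 0"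
    using wide_system_kernel[of n r "\<lambda>a i. u i $ a"] by auto
  have "c j = 0" if "j < r" for j
    using orthonormal_coefficient[OF assms that, of c] c(1) by simp
  with c(2) show False by blast
qed

lemma cols_family_mat:
  assumes "orthonormal_family n r u"
  shows "set (cols (family_mat n r u)) = u ` {..<r}"
proof -
  have "col (family_mat n r u) i = u i" if "i < r" for i
    using assms that by (intro eq_vecI) (auto simp: family_mat_def orthonormal_family_def)
  then show ?thesis unfolding cols_def by (auto simp: family_mat_def)
qed

lemma rank_family_mat:
  assumes "orthonormal_family n r u"
  shows "vec_space.rank n (family_mat n r u) = r"
proof (rule rank_injective)
  show "family_mat n r u \<in> carrier_mat n r" by (simp add: family_mat_def)
next
  fix x assume x: "x \<in> carrier_vec r" "family_mat n r u *\<^sub>v x = 0\<^sub>v n"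
  have 0: "(\<Sum>i<r. u i $ a * x $ i) = 0" if "a < n" for a
    using arg_cong[OF x(2), of "\<lambda>y. y $ a"] that x(1) by (simp add: family_mat_mult)
  show "x = 0\<^sub>v r"
    using orthonormal_coefficient[OF assms, of _ "\<lambda>i. x $ i"] 0 x(1) by (intro eq_vecI) auto
qed

lemma cdim_orthonormal:
  assumes "orthonormal_family n r u"
  shows "cdim n (cspan n (u ` {..<r})) = r"
  using rank_family_mat[OF assms] cols_family_mat[OF assms]
  by (simp add: vec_space.rank_def cdim_def cspan_def)

lemma mem_cspan_orthonormal:
  assumes "orthonormal_family n r u"
  shows "y \<in> cspan n (u ` {..<r}) \<longleftrightarrow> (\<exists>c. y = Matrix.vec n (\<lambda>a. \<Sum>i<r. u i $ a * c i))"
proof -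
  interpret vec_space "TYPE(complex)" n .
  have U: "family_mat n r u \<in> carrier_mat n r" by (simp add: family_mat_def)
  have "cspan n (u ` {..<r}) = col_space (family_mat n r u)"
    by (simp add: cspan_def col_space_def cols_family_mat[OF assms])
  also have "\<dots> = {y \<in> carrier_vec n. \<exists>x\<in>carrier_vec r. family_mat n r u *\<^sub>v x = y}"
    using U by (simp add: col_space_eq[OF U])
  finally have eq: "cspan n (u ` {..<r}) = {y \<in> carrier_vec n. \<exists>x\<in>carrier_vec r. family_mat n r u *\<^sub>v x = y}" .
  show ?thesis
  proof
    assume "y \<in> cspan n (u ` {..<r})"
    then show "\<exists>c. y = Matrix.vec n (\<lambda>a. \<Sum>i<r. u i $ a * c i)"
      unfolding eq using family_mat_mult by blast
  next
    assume "\<exists>c. y = Matrix.vec n (\<lambda>a. \<Sum>i<r. u i $ a * c i)"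
    then obtain c where c: "y = Matrix.vec n (\<lambda>a. \<Sum>i<r. u i $ a * c i)" ..
    have "family_mat n r u *\<^sub>v Matrix.vec r c = y"
      unfolding c by (subst family_mat_mult) auto
    then show "y \<in> cspan n (u ` {..<r})" unfolding eq using c by auto
  qed
qed

lemma orth_proj_unit_vec:
  assumes on: "orthonormal_family n r u" and a: "a < n"
  shows "orth_proj (cspan n (u ` {..<r})) (unit_vec n a)
       = Matrix.vec n (\<lambda>b. \<Sum>i<r. u i $ b * cnj (u i $ a))"
    (is "orth_proj ?U _ = ?p")
  unfolding orth_proj_def
proof (rule the_equality)
  have ip: "(unit_vec n a - q) \<bullet>c y = cnj (y $ a) - (\<Sum>b<n. q $ b * cnj (y $ b))"
    if "q \<in> carrier_vec n" "y \<in> carrier_vec n" for q y :: "complex Matrix.vec"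
  proof -
    have "(unit_vec n a - q) \<bullet>c y = (\<Sum>b<n. (if b = a then cnj (y $ b) else 0) - q $ b * cnj (y $ b))"
      using that by (auto simp: scalar_prod_def atLeast0LessThan unit_vec_def algebra_simps intro!: sum.cong)
    then show ?thesis using a by (simp add: sum_subtractf)
  qed
  have u_mem: "u j \<in> ?U" and u_car: "u j \<in> carrier_vec n" if "j < r" for j
  proof -
    show "u j \<in> carrier_vec n" using on that by (simp add: orthonormal_family_def)
    then have "u j = Matrix.vec n (\<lambda>b. \<Sum>i<r. u i $ b * (if i = j then 1 else 0))"
      using that by (intro eq_vecI) (auto simp: if_distrib cong: if_cong)
    then show "u j \<in> ?U" unfolding mem_cspan_orthonormal[OF on] by fast
  qed
  show "?p \<in> ?U \<and> (\<forall>y\<in>?U. (unit_vec n a - ?p) \<bullet>c y = 0)"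
  proof (intro conjI ballI)
    show "?p \<in> ?U" unfolding mem_cspan_orthonormal[OF on] by fast
    fix y assume "y \<in> ?U"
    then obtain c where y: "y = Matrix.vec n (\<lambda>b. \<Sum>i<r. u i $ b * c i)"
      unfolding mem_cspan_orthonormal[OF on] by fast
    define q where "q b = (\<Sum>k<r. u k $ b * cnj (u k $ a))" for b
    have "(\<Sum>b<n. ?p $ b * cnj (y $ b)) = (\<Sum>b<n. \<Sum>i<r. cnj (c i) * (q b * cnj (u i $ b)))"
      by (simp add: y q_def[symmetric] sum_distrib_left mult_ac)
    also have "\<dots> = (\<Sum>i<r. cnj (c i) * (\<Sum>b<n. q b * cnj (u i $ b)))"
      by (subst sum.swap) (simp add: sum_distrib_left)
    also have "\<dots> = (\<Sum>i<r. cnj (c i) * cnj (u i $ a))"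
      using orthonormal_coefficient[OF on] by (simp add: q_def)
    also have "\<dots> = cnj (y $ a)"
      using a by (simp add: y mult.commute)
    finally show "(unit_vec n a - ?p) \<bullet>c y = 0" by (subst ip) (auto simp: y)
  qed
  fix q assume q: "q \<in> ?U \<and> (\<forall>y\<in>?U. (unit_vec n a - q) \<bullet>c y = 0)"
  then obtain c where c: "q = Matrix.vec n (\<lambda>b. \<Sum>i<r. u i $ b * c i)"
    unfolding mem_cspan_orthonormal[OF on] by fast
  have "c j = cnj (u j $ a)" if j: "j < r" for j
  proof -
    have "(unit_vec n a - q) \<bullet>c u j = 0" using q u_mem[OF j] by blast
    then have "cnj (u j $ a) = (\<Sum>b<n. q $ b * cnj (u j $ b))"
      using u_car[OF j] by (subst (asm) ip) (auto simp: c)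
    also have "\<dots> = c j" using orthonormal_coefficient[OF on j, of c] by (simp add: c)
    finally show ?thesis by simp
  qed
  then show "q = ?p" unfolding c by simp
qed

lemma sq_norm2_orth_proj_unit_vec:
  assumes "orthonormal_family n r u" "a < n"
  shows "sq_norm2 (orth_proj (cspan n (u ` {..<r})) (unit_vec n a)) = (\<Sum>i<r. (cmod (u i $ a))\<^sup>2)"
  using orthonormal_norm[OF assms(1), of "\<lambda>i. cnj (u i $ a)"]
  by (simp add: orth_proj_unit_vec[OF assms] sq_norm2_def)

lemma coherence_orthonormal_le:
  assumes on: "orthonormal_family n r u" and "0 < n"
    and le: "\<And>a. a < n \<Longrightarrow> (\<Sum>i<r. (cmod (u i $ a))\<^sup>2) \<le> B"
  shows "coherence n (cspan n (u ` {..<r})) \<le> real n / real r * B"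
proof -
  have "Max ((\<lambda>a. sq_norm2 (orth_proj (cspan n (u ` {..<r})) (unit_vec n a))) ` {..<n}) \<le> B"
    using assms by (subst Max_le_iff) (auto simp: sq_norm2_orth_proj_unit_vec)
  then show ?thesis
    unfolding coherence_def cdim_orthonormal[OF on] by (intro mult_left_mono) auto
qed

subsection \<open>Existence of a compact singular value decomposition\<close>

lemma trace_similar:
  fixes A :: "'a :: comm_ring_1 Matrix.mat"
  assumes A: "A \<in> carrier_mat n n" and sim: "similar_mat_wit A B P Q"
  shows "(\<Sum>i<n. A $$ (i, i)) = (\<Sum>i<n. B $$ (i, i))"
proof -
  note w = similar_mat_witD2[OF A sim]
  have swap: "(\<Sum>i<n. (X * Y) $$ (i, i)) = (\<Sum>i<n. (Y * X) $$ (i, i))"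
    if "X \<in> carrier_mat n n" "Y \<in> carrier_mat n n" for X Y :: "'a Matrix.mat"
  proof -
    have "(\<Sum>i<n. (X * Y) $$ (i, i)) = (\<Sum>i<n. \<Sum>j<n. X $$ (i, j) * Y $$ (j, i))"
      using that by (simp add: scalar_prod_def atLeast0LessThan)
    also have "\<dots> = (\<Sum>i<n. (Y * X) $$ (i, i))"
      using that
      by (subst sum.swap) (simp add: scalar_prod_def atLeast0LessThan mult.commute)
    finally show ?thesis .
  qed
  have "(\<Sum>i<n. A $$ (i, i)) = (\<Sum>i<n. (Q * (P * B)) $$ (i, i))"
    unfolding w(3) using w(4-7) by (intro swap) auto
  also have "Q * (P * B) = B" using w(2,4-7) by (simp flip: assoc_mult_mat[of Q n n P n B n])
  finally show ?thesis .
qed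

lemma nonzero_trace_eigenvalue:
  fixes B :: "complex Matrix.mat"
  assumes B: "B \<in> carrier_mat n n" and tr: "(\<Sum>i<n. B $$ (i, i)) \<noteq> 0"
  obtains e where "eigenvalue B e" "e \<noteq> 0"
proof -
  obtain es where es: "char_poly B = (\<Prod>a\<leftarrow>es. [:- a, 1:])"
    using char_poly_factorized[OF B] by blast
  obtain T P Q where "schur_decomposition B es = (T, P, Q)" by (metis prod_cases3)
  from schur_decomposition[OF B es this]
  have sim: "similar_mat_wit B T P Q" and diag: "diag_mat T = es" by auto
  have T: "T \<in> carrier_mat n n" using similar_mat_witD2[OF B sim] by simp
  have "(\<Sum>i<n. T $$ (i, i)) \<noteq> 0" using trace_similar[OF B sim] tr by simp
  then obtain i where i: "i < n" "T $$ (i, i) \<noteq> 0" by (metis (no_types, lifting) lessThan_iff sum.neutral)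
  then have "T $$ (i, i) \<in> set es" using T by (auto simp: diag[symmetric] diag_mat_def)
  then have "poly (char_poly B) (T $$ (i, i)) = 0"
    by (auto simp: es poly_prod_list prod_list_zero_iff image_iff)
  with i show thesis using eigenvalue_root_char_poly[OF B] that by blast
qed

lemma sum_mult_cnj: "(\<Sum>a<m. f a * cnj (f a)) = complex_of_real (\<Sum>a<m. (cmod (f a))\<^sup>2)"
  by (simp only: of_real_sum complex_norm_square)

text \<open>The trace of \<open>A\<^sup>H A\<close> is the squared Frobenius norm of \<open>A\<close>; hence \<open>A\<^sup>H A\<close> has a
  nonzero eigenvalue, whose square root is a singular value.\<close>

lemma exists_singular_triple:
  assumes A: "A \<in> carrier_mat m n" and "A \<noteq> 0\<^sub>m m n"
  obtains s p q where "(0::real) < s"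
    "(\<Sum>a<m. p a * cnj (p a)) = 1" "(\<Sum>b<n. q b * cnj (q b)) = 1"
    "\<forall>a<m. (\<Sum>b<n. A $$ (a, b) * q b) = complex_of_real s * p a"
    "\<forall>b<n. (\<Sum>a<m. cnj (A $$ (a, b)) * p a) = complex_of_real s * q b"
proof -
  define B where "B = Matrix.mat n n (\<lambda>(b, b'). \<Sum>a<m. cnj (A $$ (a, b)) * A $$ (a, b'))"
  have B: "B \<in> carrier_mat n n" by (simp add: B_def)
  define F where "F = (\<Sum>b<n. \<Sum>a<m. (cmod (A $$ (a, b)))\<^sup>2)"
  have "F \<noteq> 0"
  proof
    assume "F = 0"
    then have "A $$ (a, b) = 0" if "a < m" "b < n" for a b
      using that by (simp add: F_def sum_nonneg_eq_0_iff sum_nonneg)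
    then have "A = 0\<^sub>m m n" using A by (intro eq_matI) auto
    with assms show False by simp
  qed
  moreover have "(\<Sum>b<n. B $$ (b, b)) = of_real F"
    unfolding F_def of_real_sum[of _ "{..<n}"] sum_mult_cnj[symmetric]
    by (simp add: B_def mult.commute)
  ultimately have "(\<Sum>b<n. B $$ (b, b)) \<noteq> 0" by simp
  then obtain e where e: "eigenvalue B e" "e \<noteq> 0" using nonzero_trace_eigenvalue[OF B] by blast
  then obtain y where y: "y \<in> carrier_vec n" "y \<noteq> 0\<^sub>v n" "B *\<^sub>v y = e \<cdot>\<^sub>v y"
    using B by (auto simp: eigenvalue_def eigenvector_def)
  define z where "z a = (\<Sum>b<n. A $$ (a, b) * y $ b)" for a
  have Bz: "(\<Sum>a<m. cnj (A $$ (a, b)) * z a) = e * y $ b" if "b < n" for b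
  proof -
    have "(\<Sum>a<m. cnj (A $$ (a, b)) * z a) = (\<Sum>b'<n. B $$ (b, b') * y $ b')"
      using that unfolding z_def
      by (simp add: B_def sum_distrib_left sum_distrib_right mult.assoc) (rule sum.swap)
    also have "\<dots> = (B *\<^sub>v y) $ b"
      using that y(1) B by (simp add: scalar_prod_def atLeast0LessThan)
    also have "\<dots> = e * y $ b" using that y by simp
    finally show ?thesis .
  qed
  define N where "N = (\<Sum>b<n. (cmod (y $ b))\<^sup>2)"
  have "N \<noteq> 0"
  proof
    assume "N = 0"
    then have "y = 0\<^sub>v n" using y(1) by (intro eq_vecI) (auto simp: N_def sum_nonneg_eq_0_iff)
    with y show False by simp
  qed
  then have N: "N > 0" unfolding N_def by (metis less_eq_real_def sum_nonneg zero_le_power2)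
  define Z where "Z = (\<Sum>a<m. (cmod (z a))\<^sup>2)"
  have "e * of_real N = (\<Sum>b<n. (\<Sum>a<m. cnj (A $$ (a, b)) * z a) * cnj (y $ b))"
    by (simp add: N_def sum_mult_cnj[symmetric] Bz sum_distrib_left mult.assoc del: of_real_sum)
  also have "\<dots> = (\<Sum>b<n. \<Sum>a<m. z a * cnj (A $$ (a, b) * y $ b))"
    by (simp add: sum_distrib_left sum_distrib_right mult_ac)
  also have "\<dots> = (\<Sum>a<m. z a * cnj (z a))"
    by (subst sum.swap) (simp add: z_def sum_distrib_left)
  also have "\<dots> = of_real Z" unfolding Z_def by (rule sum_mult_cnj)
  finally have eN: "e * of_real N = of_real Z" .
  then have e_eq: "e = of_real (Z / N)" using N by (simp add: field_simps)
  have "Z \<ge> 0" by (simp add: Z_def sum_nonneg)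
  then have Z: "Z > 0" using e(2) e_eq by (cases "Z = 0") auto
  define s where "s = sqrt (Z / N)"
  have s: "s > 0" "s * s = Z / N" using Z N by (simp_all add: s_def)
  show thesis
  proof (rule that[of s "\<lambda>a. z a / of_real (sqrt Z)" "\<lambda>b. y $ b / of_real (sqrt N)"])
    have *: "x / of_real (sqrt w) * cnj (x / of_real (sqrt w)) = x * cnj x / of_real w" if "w > 0" for x w
      using that by (simp flip: of_real_mult)
    show "(\<Sum>a<m. z a / of_real (sqrt Z) * cnj (z a / of_real (sqrt Z))) = 1"
      unfolding *[OF Z] using Z by (simp only: sum_divide_distrib[symmetric] sum_mult_cnj flip: Z_def) simp
    show "(\<Sum>b<n. y $ b / of_real (sqrt N) * cnj (y $ b / of_real (sqrt N))) = 1"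
      unfolding *[OF N] using N by (simp only: sum_divide_distrib[symmetric] sum_mult_cnj flip: N_def) simp
    have sZ: "s * sqrt N = sqrt Z" using N by (simp add: s_def real_sqrt_divide)
    show "\<forall>a<m. (\<Sum>b<n. A $$ (a, b) * (y $ b / of_real (sqrt N))) = of_real s * (z a / of_real (sqrt Z))"
    proof (intro allI impI)
      fix a
      have "(\<Sum>b<n. A $$ (a, b) * (y $ b / of_real (sqrt N))) = z a / of_real (sqrt N)"
        by (simp add: z_def sum_divide_distrib)
      then show "(\<Sum>b<n. A $$ (a, b) * (y $ b / of_real (sqrt N))) = of_real s * (z a / of_real (sqrt Z))"
        using N s(1) by (simp flip: sZ)
    qed
    show "\<forall>b<n. (\<Sum>a<m. cnj (A $$ (a, b)) * (z a / of_real (sqrt Z))) = of_real s * (y $ b / of_real (sqrt N))"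
    proof (intro allI impI)
      fix b assume "b < n"
      have "(\<Sum>a<m. cnj (A $$ (a, b)) * (z a / of_real (sqrt Z))) = e * y $ b / of_real (sqrt Z)"
        by (simp add: Bz[OF \<open>b < n\<close>, symmetric] sum_divide_distrib)
      also have "\<dots> = of_real s * (y $ b / of_real (sqrt N))"
        unfolding e_eq s(2)[symmetric] using N s(1) by (simp flip: sZ)
      finally show "(\<Sum>a<m. cnj (A $$ (a, b)) * (z a / of_real (sqrt Z))) = of_real s * (y $ b / of_real (sqrt N))" .
    qed
  qed (use s in simp)
qed

lemma outer_sum_mult:
  assumes "a < m"
  shows "(\<Sum>b<n. outer_sum m n r s u v $$ (a, b) * x b)
       = (\<Sum>i<r. of_real (s i) * u i $ a * (\<Sum>b<n. x b * cnj (v i $ b)))"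
  using assms
  by (simp add: outer_sum_def sum_distrib_left sum_distrib_right mult_ac, subst sum.swap) simp

lemma outer_sum_adjoint_mult:
  assumes "b < n"
  shows "(\<Sum>a<m. cnj (outer_sum m n r s u v $$ (a, b)) * x a)
       = (\<Sum>i<r. of_real (s i) * v i $ b * (\<Sum>a<m. x a * cnj (u i $ a)))"
  using assms
  by (simp add: outer_sum_def sum_distrib_left sum_distrib_right mult_ac, subst sum.swap) simp

lemma outer_sum_singular:
  assumes "orthonormal_family n r v" "i < r" "a < m"
  shows "(\<Sum>b<n. outer_sum m n r s u v $$ (a, b) * v i $ b) = of_real (s i) * u i $ a"
proof -
  have "(\<Sum>b<n. outer_sum m n r s u v $$ (a, b) * v i $ b)
      = (\<Sum>j<r. of_real (s j) * u j $ a * (if i = j then 1 else 0))"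
    unfolding outer_sum_mult[OF assms(3)]
    using assms by (intro sum.cong refl) (simp add: orthonormal_familyD[of n r v i])
  then show ?thesis using assms(2) by (simp add: if_distrib cong: if_cong)
qed

lemma outer_sum_adjoint_singular:
  assumes "orthonormal_family m r u" "i < r" "b < n"
  shows "(\<Sum>a<m. cnj (outer_sum m n r s u v $$ (a, b)) * u i $ a) = of_real (s i) * v i $ b"
proof -
  have "(\<Sum>a<m. cnj (outer_sum m n r s u v $$ (a, b)) * u i $ a)
      = (\<Sum>j<r. of_real (s j) * v j $ b * (if i = j then 1 else 0))"
    unfolding outer_sum_adjoint_mult[OF assms(3)]
    using assms by (intro sum.cong refl) (simp add: orthonormal_familyD[of m r u i])
  then show ?thesis using assms(2) by (simp add: if_distrib cong: if_cong)
qed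

lemma rank_outer_sum:
  assumes s: "\<And>i. i < r \<Longrightarrow> 0 < s i"
    and u: "orthonormal_family m r u" and v: "orthonormal_family n r v"
  shows "vec_space.rank m (outer_sum m n r s u v) = r"
proof -
  interpret vec_space "TYPE(complex)" m .
  let ?O = "outer_sum m n r s u v"
  let ?U = "family_mat m r u"
  have O: "?O \<in> carrier_mat m n" by (simp add: outer_sum_def)
  have U: "?U \<in> carrier_mat m r" by (simp add: family_mat_def)
  have 1: "\<exists>y\<in>carrier_vec r. ?U *\<^sub>v y = ?O *\<^sub>v x" if x: "x \<in> carrier_vec n" for x
  proof (rule bexI)
    let ?y = "Matrix.vec r (\<lambda>i. of_real (s i) * (\<Sum>b<n. x $ b * cnj (v i $ b)))"
    show "?U *\<^sub>v ?y = ?O *\<^sub>v x"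
    proof (rule eq_vecI)
      fix a assume "a < dim_vec (?O *\<^sub>v x)"
      then have a: "a < m" using O by simp
      have "(?O *\<^sub>v x) $ a = (\<Sum>b<n. ?O $$ (a, b) * x $ b)"
        using a x O by (simp add: scalar_prod_def atLeast0LessThan)
      also have "\<dots> = (?U *\<^sub>v ?y) $ a"
        unfolding outer_sum_mult[OF a] using a by (simp add: family_mat_mult mult_ac)
      finally show "(?U *\<^sub>v ?y) $ a = (?O *\<^sub>v x) $ a" ..
    qed (simp add: outer_sum_def family_mat_def)
  qed simp
  have 2: "\<exists>x\<in>carrier_vec n. ?O *\<^sub>v x = ?U *\<^sub>v y" if y: "y \<in> carrier_vec r" for y
  proof (rule bexI)
    let ?x = "Matrix.vec n (\<lambda>b. \<Sum>i<r. v i $ b * (y $ i / of_real (s i)))"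
    show "?O *\<^sub>v ?x = ?U *\<^sub>v y"
    proof (rule eq_vecI)
      fix a assume "a < dim_vec (?U *\<^sub>v y)"
      then have a: "a < m" using U by simp
      have "(?O *\<^sub>v ?x) $ a = (\<Sum>b<n. ?O $$ (a, b) * ?x $ b)"
        using a O by (simp add: scalar_prod_def atLeast0LessThan)
      also have "\<dots> = (\<Sum>i<r. of_real (s i) * u i $ a * (y $ i / of_real (s i)))"
        unfolding outer_sum_mult[OF a]
      proof (intro sum.cong refl)
        fix i assume "i \<in> {..<r}"
        then have "(\<Sum>b<n. (\<Sum>j<r. v j $ b * (y $ j / of_real (s j))) * cnj (v i $ b)) = y $ i / of_real (s i)"
          by (intro orthonormal_coefficient[OF v]) simp
        then show "of_real (s i) * u i $ a * (\<Sum>b<n. ?x $ b * cnj (v i $ b))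
            = of_real (s i) * u i $ a * (y $ i / of_real (s i))" by simp
      qed
      also have "\<dots> = (\<Sum>i<r. u i $ a * y $ i)"
        using s by (intro sum.cong) (auto simp: less_imp_neq[symmetric])
      also have "\<dots> = (?U *\<^sub>v y) $ a"
        using a y by (simp add: family_mat_mult)
      finally show "(?O *\<^sub>v ?x) $ a = (?U *\<^sub>v y) $ a" .
    qed (simp add: outer_sum_def family_mat_def)
  qed simp
  have "col_space ?O = col_space ?U"
    unfolding col_space_eq[OF O] col_space_eq[OF U]
    using 1 2 O U by auto
  then have "rank ?O = rank ?U" by (simp add: rank_def col_space_def)
  then show ?thesis using rank_family_mat[OF u] by simp
qed

lemma orthonormal_family_extend:
  assumes u: "orthonormal_family n r u" and p: "(\<Sum>a<n. p a * cnj (p a)) = 1"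
    and orth: "\<And>i. i < r \<Longrightarrow> (\<Sum>a<n. p a * cnj (u i $ a)) = 0"
  shows "orthonormal_family n (Suc r) (u(r := Matrix.vec n p))"
proof (rule orthonormal_familyI)
  fix i assume "i < Suc r"
  then show "(u(r := Matrix.vec n p)) i \<in> carrier_vec n"
    using u by (auto simp: orthonormal_family_def less_Suc_eq)
next
  fix i j assume ij: "i < Suc r" "j < Suc r"
  have "(\<Sum>a<n. u i $ a * cnj (p a)) = cnj (\<Sum>a<n. p a * cnj (u i $ a))"
    by (simp add: mult.commute)
  then have orth': "(\<Sum>a<n. u i $ a * cnj (p a)) = 0" if "i < r" using orth[OF that] by simp
  show "(\<Sum>a<n. (u(r := Matrix.vec n p)) i $ a * cnj ((u(r := Matrix.vec n p)) j $ a)) = (if i = j then 1 else 0)"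
    using ij p orth orth' orthonormal_familyD[OF u] by (auto simp: less_Suc_eq)
qed

definition singular_system ::
    "complex Matrix.mat \<Rightarrow> nat \<Rightarrow> (nat \<Rightarrow> real) \<Rightarrow> (nat \<Rightarrow> complex Matrix.vec)
      \<Rightarrow> (nat \<Rightarrow> complex Matrix.vec) \<Rightarrow> bool" where
  "singular_system A r s u v \<longleftrightarrow>
     orthonormal_family (dim_row A) r u \<and> orthonormal_family (dim_col A) r v \<and>
     (\<forall>i<r. 0 < s i \<and>
        (\<forall>a<dim_row A. (\<Sum>b<dim_col A. A $$ (a, b) * v i $ b) = of_real (s i) * u i $ a) \<and>
        (\<forall>b<dim_col A. (\<Sum>a<dim_row A. cnj (A $$ (a, b)) * u i $ a) = of_real (s i) * v i $ b))"

text \<open>Deflation: a singular triple of \<open>A\<close> minus the outer sum of a singular system is automatically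
  orthogonal to the system, hence also a singular triple of \<open>A\<close>.\<close>

lemma singular_system_extend:
  assumes sys: "singular_system A r s u v"
    and ne: "A \<noteq> outer_sum (dim_row A) (dim_col A) r s u v"
  shows "\<exists>s u v. singular_system A (Suc r) s u v"
proof -
  define m n where "m = dim_row A" and "n = dim_col A"
  define O' where "O' = outer_sum m n r s u v"
  define A' where "A' = A - O'"
  have A: "A \<in> carrier_mat m n" by (simp add: m_def n_def)
  have O': "O' \<in> carrier_mat m n" by (simp add: O'_def outer_sum_def)
  have A': "A' \<in> carrier_mat m n" unfolding A'_def by (rule minus_carrier_mat[OF O'])
  have A'_index: "A' $$ (a, b) = A $$ (a, b) - O' $$ (a, b)" if "a < m" "b < n" for a b
    using that A O' by (simp add: A'_def)
  have u: "orthonormal_family m r u" and v: "orthonormal_family n r v"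
    using sys by (auto simp: singular_system_def m_def n_def)
  have Av: "(\<Sum>b<n. A $$ (a, b) * v i $ b) = of_real (s i) * u i $ a" if "i < r" "a < m" for i a
    using sys that by (simp add: singular_system_def m_def n_def)
  have Au: "(\<Sum>a<m. cnj (A $$ (a, b)) * u i $ a) = of_real (s i) * v i $ b" if "i < r" "b < n" for i b
    using sys that by (simp add: singular_system_def m_def n_def)
  have "A' \<noteq> 0\<^sub>m m n"
  proof
    assume 0: "A' = 0\<^sub>m m n"
    have "A $$ (a, b) = O' $$ (a, b)" if "a < m" "b < n" for a b
      using A'_index[OF that] that by (simp add: 0)
    then have "A = O'" using A O' by (intro eq_matI) auto
    with ne show False unfolding O'_def m_def n_def by blast
  qed
  then obtain t p q where t: "(0::real) < t"
    and p: "(\<Sum>a<m. p a * cnj (p a)) = 1" and q: "(\<Sum>b<n. q b * cnj (q b)) = 1"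
    and *: "\<forall>a<m. (\<Sum>b<n. A' $$ (a, b) * q b) = complex_of_real t * p a"
      "\<forall>b<n. (\<Sum>a<m. cnj (A' $$ (a, b)) * p a) = complex_of_real t * q b"
    by (rule exists_singular_triple[OF A'])
  have A'q: "(\<Sum>b<n. A' $$ (a, b) * q b) = of_real t * p a" if "a < m" for a
    using *(1) that by blast
  have A'p: "(\<Sum>a<m. cnj (A' $$ (a, b)) * p a) = of_real t * q b" if "b < n" for b
    using *(2) that by blast
  have A'v: "(\<Sum>b<n. A' $$ (a, b) * v i $ b) = 0" if "i < r" "a < m" for i a
    using that by (simp add: A'_index left_diff_distrib sum_subtractf Av O'_def outer_sum_singular[OF v])
  have A'u: "(\<Sum>a<m. cnj (A' $$ (a, b)) * u i $ a) = 0" if "i < r" "b < n" for i b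
    using that
    by (simp add: A'_index left_diff_distrib sum_subtractf Au O'_def outer_sum_adjoint_singular[OF u])
  have orth_p: "(\<Sum>a<m. p a * cnj (u i $ a)) = 0" if i: "i < r" for i
  proof -
    have "of_real t * (\<Sum>a<m. p a * cnj (u i $ a)) = (\<Sum>a<m. (\<Sum>b<n. A' $$ (a, b) * q b) * cnj (u i $ a))"
      by (simp add: A'q sum_distrib_left mult.assoc)
    also have "\<dots> = (\<Sum>b<n. q b * cnj (\<Sum>a<m. cnj (A' $$ (a, b)) * u i $ a))"
      by (simp add: sum_distrib_left sum_distrib_right mult_ac, subst sum.swap) simp
    also have "\<dots> = 0" by (simp add: A'u[OF i] del: cnj_sum)
    finally show ?thesis using t by simp
  qed
  have orth_q: "(\<Sum>b<n. q b * cnj (v i $ b)) = 0" if i: "i < r" for i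
  proof -
    have "of_real t * (\<Sum>b<n. q b * cnj (v i $ b)) = (\<Sum>b<n. (\<Sum>a<m. cnj (A' $$ (a, b)) * p a) * cnj (v i $ b))"
      by (simp add: A'p sum_distrib_left mult.assoc)
    also have "\<dots> = (\<Sum>a<m. p a * cnj (\<Sum>b<n. A' $$ (a, b) * v i $ b))"
      by (simp add: sum_distrib_left sum_distrib_right mult_ac, subst sum.swap) simp
    also have "\<dots> = 0" by (simp add: A'v[OF i] del: cnj_sum)
    finally show ?thesis using t by simp
  qed
  have Aq: "(\<Sum>b<n. A $$ (a, b) * q b) = of_real t * p a" if "a < m" for a
  proof -
    have "(\<Sum>b<n. O' $$ (a, b) * q b) = 0"
      unfolding O'_def outer_sum_mult[OF that] by (simp add: orth_q)
    then show ?thesis using A'q[OF that] that by (simp add: A'_index left_diff_distrib sum_subtractf)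
  qed
  have Ap: "(\<Sum>a<m. cnj (A $$ (a, b)) * p a) = of_real t * q b" if "b < n" for b
  proof -
    have "(\<Sum>a<m. cnj (O' $$ (a, b)) * p a) = 0"
      unfolding O'_def outer_sum_adjoint_mult[OF that] by (simp add: orth_p)
    then show ?thesis using A'p[OF that] that by (simp add: A'_index left_diff_distrib sum_subtractf)
  qed
  have "singular_system A (Suc r) (s(r := t)) (u(r := Matrix.vec m p)) (v(r := Matrix.vec n q))"
    using orthonormal_family_extend[OF u p orth_p] orthonormal_family_extend[OF v q orth_q]
      sys t Aq Ap
    by (auto simp: singular_system_def m_def n_def less_Suc_eq)
  then show ?thesis by blast
qed

lemma compact_svd_exists: "\<exists>r s u v. compact_svd A r s u v"
proof -
  define size where "size r \<longleftrightarrow> (\<exists>s u v. singular_system A r s u v)" for r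
  have "size 0" by (simp add: size_def singular_system_def orthonormal_family_def)
  moreover have "\<forall>r. size r \<longrightarrow> r < Suc (dim_row A)"
  proof (intro allI impI)
    fix r assume "size r"
    then obtain u where "orthonormal_family (dim_row A) r u"
      unfolding size_def singular_system_def by blast
    from orthonormal_family_size[OF this] show "r < Suc (dim_row A)" by simp
  qed
  ultimately have "\<exists>r. size r \<and> (\<forall>r'. size r' \<longrightarrow> r' \<le> r)"
    by (rule ex_has_greatest_nat)
  then obtain r where r: "size r" "\<And>r'. size r' \<Longrightarrow> r' \<le> r" by blast
  then obtain s u v where sys: "singular_system A r s u v" unfolding size_def by blast
  have eq: "A = outer_sum (dim_row A) (dim_col A) r s u v"
  proof (rule ccontr)
    assume "A \<noteq> outer_sum (dim_row A) (dim_col A) r s u v"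
    then have "size (Suc r)" unfolding size_def by (rule singular_system_extend[OF sys])
    from r(2)[OF this] show False by simp
  qed
  have "vec_space.rank (dim_row A) (outer_sum (dim_row A) (dim_col A) r s u v) = r"
    using sys by (intro rank_outer_sum) (auto simp: singular_system_def)
  then have "r = vec_space.rank (dim_row A) A" by (simp only: eq[symmetric])
  then have "compact_svd A r s u v"
    unfolding compact_svd_def using sys eq unfolding singular_system_def by blast
  then show ?thesis by blast
qed

subsection \<open>Diagonally dominant Gram matrices\<close>

definition coercive :: "nat \<Rightarrow> nat \<Rightarrow> (nat \<Rightarrow> nat \<Rightarrow> complex) \<Rightarrow> real \<Rightarrow> bool" where
  "coercive M K X lam \<longleftrightarrow>
     (\<forall>c. lam * (\<Sum>k<K. (cmod (c k))\<^sup>2) \<le> (\<Sum>l<M. (cmod (\<Sum>k<K. X l k * c k))\<^sup>2))"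

lemma coercive_kernel:
  assumes "coercive M K X lam" "0 < lam" "\<And>l. l < M \<Longrightarrow> (\<Sum>k<K. X l k * c k) = 0" "k < K"
  shows "c k = 0"
proof -
  have "lam * (\<Sum>k<K. (cmod (c k))\<^sup>2) \<le> (\<Sum>l<M. (cmod (\<Sum>k<K. X l k * c k))\<^sup>2)"
    using assms(1) unfolding coercive_def by blast
  also have "\<dots> = 0" using assms(3) by simp
  finally have "(\<Sum>k<K. (cmod (c k))\<^sup>2) \<le> 0" using assms(2) by (simp add: mult_le_0_iff)
  moreover have "(\<Sum>k<K. (cmod (c k))\<^sup>2) \<ge> 0" by (simp add: sum_nonneg)
  ultimately have "(\<Sum>k<K. (cmod (c k))\<^sup>2) = 0" by simp
  then show ?thesis using assms(4) by (simp add: sum_nonneg_eq_0_iff)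
qed

lemma coercive_unimodular:
  assumes one: "\<And>l k. l < M \<Longrightarrow> k < K \<Longrightarrow> cmod (X l k) = 1"
    and off: "\<And>k k'. k < K \<Longrightarrow> k' < K \<Longrightarrow> k \<noteq> k' \<Longrightarrow> cmod (\<Sum>l<M. X l k * cnj (X l k')) \<le> b"
    and b: "0 \<le> b"
  shows "coercive M K X (real M - (real K - 1) * b)"
  unfolding coercive_def
proof
  fix c :: "nat \<Rightarrow> complex"
  define S where "S = (\<Sum>k<K. (cmod (c k))\<^sup>2)"
  define G where "G k k' = (\<Sum>l<M. X l k * cnj (X l k'))" for k k'
  have G_diag: "G k k = of_nat M" if "k < K" for k
    using one that by (simp add: G_def complex_norm_square[symmetric] del: of_real_power)
  have "complex_of_real (\<Sum>l<M. (cmod (\<Sum>k<K. X l k * c k))\<^sup>2)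
      = (\<Sum>l<M. (\<Sum>k<K. X l k * c k) * cnj (\<Sum>k<K. X l k * c k))"
    by (rule sum_mult_cnj[symmetric])
  also have "\<dots> = (\<Sum>l<M. \<Sum>k<K. \<Sum>k'<K. c k * cnj (c k') * (X l k * cnj (X l k')))"
    by (simp add: sum_product mult_ac)
  also have "\<dots> = (\<Sum>k<K. \<Sum>k'<K. \<Sum>l<M. c k * cnj (c k') * (X l k * cnj (X l k')))"
    by (rule trans[OF sum.swap]) (rule sum.cong[OF refl sum.swap])
  also have "\<dots> = (\<Sum>k<K. \<Sum>k'<K. c k * cnj (c k') * G k k')"
    by (simp add: G_def sum_distrib_left)
  finally have "(\<Sum>l<M. (cmod (\<Sum>k<K. X l k * c k))\<^sup>2) = Re (\<Sum>k<K. \<Sum>k'<K. c k * cnj (c k') * G k k')"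
    by (metis Re_complex_of_real)
  also have "\<dots> = (\<Sum>k<K. \<Sum>k'<K. Re (c k * cnj (c k') * G k k'))"
    by (simp only: Re_sum)
  also have "\<dots> \<ge> (\<Sum>k<K. \<Sum>k'<K. - (b / 2) * (cmod (c k))\<^sup>2 + (- (b / 2) * (cmod (c k'))\<^sup>2
      + (if k = k' then (real M + b) * (cmod (c k))\<^sup>2 else 0)))" (is "_ \<ge> ?R")
  proof (intro sum_mono)
    fix k k' assume "k \<in> {..<K}" "k' \<in> {..<K}"
    then have k: "k < K" "k' < K" by auto
    show "- (b / 2) * (cmod (c k))\<^sup>2 + (- (b / 2) * (cmod (c k'))\<^sup>2
      + (if k = k' then (real M + b) * (cmod (c k))\<^sup>2 else 0)) \<le> Re (c k * cnj (c k') * G k k')"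
    proof (cases "k = k'")
      case True
      have "c k * cnj (c k) * G k k = complex_of_real ((cmod (c k))\<^sup>2 * real M)"
        by (simp only: G_diag[OF k(1)] complex_norm_square[symmetric]) simp
      then show ?thesis using True by (simp add: algebra_simps del: of_real_mult of_real_power)
    next
      case False
      have "- Re (c k * cnj (c k') * G k k') \<le> cmod (c k * cnj (c k') * G k k')"
        using abs_Re_le_cmod[of "c k * cnj (c k') * G k k'"] by linarith
      also have "\<dots> = cmod (c k) * cmod (c k') * cmod (G k k')" by (simp add: norm_mult)
      also have "\<dots> \<le> cmod (c k) * cmod (c k') * b"
        using off[OF k False] by (intro mult_left_mono) (simp_all add: G_def)
      also have "\<dots> \<le> (((cmod (c k))\<^sup>2 + (cmod (c k'))\<^sup>2) / 2) * b"
        using sum_squares_bound[of "cmod (c k)" "cmod (c k')"] b by (intro mult_right_mono) auto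
      finally show ?thesis using False by (simp add: field_simps)
    qed
  qed
  also have "?R = (real M - (real K - 1) * b) * S"
  proof -
    have "(\<Sum>k<K. \<Sum>k'<K. - (b / 2) * (cmod (c k))\<^sup>2) = real K * (- (b / 2) * S)"
      by (simp add: S_def sum_distrib_left sum_negf)
    moreover have "(\<Sum>k<K. \<Sum>k'<K. - (b / 2) * (cmod (c k'))\<^sup>2) = real K * (- (b / 2) * S)"
      by (simp add: S_def sum_distrib_left)
    moreover have "(\<Sum>k<K. \<Sum>k'<K. if k = k' then (real M + b) * (cmod (c k))\<^sup>2 else 0) = (real M + b) * S"
      by (simp add: S_def sum_distrib_left)
    ultimately show ?thesis by (simp only: sum.distrib) (simp add: algebra_simps)
  qed
  finally show "(real M - (real K - 1) * b) * (\<Sum>k<K. (cmod (c k))\<^sup>2)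
      \<le> (\<Sum>l<M. (cmod (\<Sum>k<K. X l k * c k))\<^sup>2)" by (simp add: S_def)
qed

lemma leverage_le:
  assumes on: "orthonormal_family M r u"
    and range: "\<And>i l. i < r \<Longrightarrow> l < M \<Longrightarrow> u i $ l = (\<Sum>k<K. X l k * C i k)"
    and coer: "coercive M K X lam" and lam: "0 < lam"
    and a: "a < M" and one: "\<And>k. k < K \<Longrightarrow> cmod (X a k) = 1"
  shows "(\<Sum>i<r. (cmod (u i $ a))\<^sup>2) \<le> real K / lam"
proof -
  define L where "L = (\<Sum>i<r. (cmod (u i $ a))\<^sup>2)"
  define c where "c k = (\<Sum>i<r. C i k * cnj (u i $ a))" for k
  define S where "S = (\<Sum>k<K. (cmod (c k))\<^sup>2)"
  have p: "(\<Sum>i<r. u i $ l * cnj (u i $ a)) = (\<Sum>k<K. X l k * c k)" if "l < M" for l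
  proof -
    have "(\<Sum>i<r. u i $ l * cnj (u i $ a)) = (\<Sum>i<r. \<Sum>k<K. X l k * (C i k * cnj (u i $ a)))"
      by (intro sum.cong refl) (simp add: range[OF _ that] sum_distrib_right mult.assoc)
    also have "\<dots> = (\<Sum>k<K. X l k * c k)"
      by (subst sum.swap) (simp add: c_def sum_distrib_left)
    finally show ?thesis .
  qed
  have "lam * S \<le> (\<Sum>l<M. (cmod (\<Sum>k<K. X l k * c k))\<^sup>2)"
    using coer unfolding coercive_def S_def by blast
  also have "\<dots> = L"
    using orthonormal_norm[OF on, of "\<lambda>i. cnj (u i $ a)"] by (simp add: p L_def)
  finally have SL: "lam * S \<le> L" .
  have L0: "L \<ge> 0" by (simp add: L_def sum_nonneg)
  have "complex_of_real L = (\<Sum>k<K. X a k * c k)"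
    unfolding L_def using p[OF a] by (simp only: sum_mult_cnj)
  then have "cmod (\<Sum>k<K. X a k * c k) = \<bar>L\<bar>" by (metis norm_of_real)
  then have "L = cmod (\<Sum>k<K. X a k * c k)" using L0 by simp
  also have "\<dots> \<le> (\<Sum>k<K. cmod (c k))"
    by (rule order.trans[OF norm_sum]) (simp add: norm_mult one)
  finally have "L\<^sup>2 \<le> (\<Sum>k<K. cmod (c k))\<^sup>2" using L0 by (rule power_mono)
  also have "\<dots> \<le> S * real K"
    using sum_squared_le_sum_of_squares[of "\<lambda>k. cmod (c k)" "{..<K}"] by (simp add: S_def mult.commute)
  finally have "lam * L\<^sup>2 \<le> lam * S * real K"
    unfolding mult.assoc using lam by (intro mult_left_mono) auto
  also have "\<dots> \<le> L * real K" using SL by (rule mult_right_mono) simp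
  finally have "L * (lam * L) \<le> L * real K" by (simp add: power2_eq_square mult_ac)
  then have "lam * L \<le> real K" using L0 by (cases "L = 0") (simp_all add: mult_le_cancel_left)
  then have "L \<le> real K / lam" using lam by (simp add: pos_le_divide_eq mult.commute)
  then show ?thesis by (simp only: L_def)
qed

text \<open>If \<open>r < K\<close>, some \<open>c \<noteq> 0\<close> makes \<open>y = cnj X\<^sub>t c\<close> orthogonal to every \<open>v i\<close>, so the outer sum
  annihilates \<open>y\<close>; coercivity of \<open>X\<^sub>r\<close> then gives \<open>X\<^sub>t\<^sup>T y = 0\<close>, whence \<open>\<parallel>y\<parallel>\<^sup>2 = 0\<close>.\<close>

lemma outer_sum_terms_ge:
  assumes eq: "\<And>a b. a < Mr \<Longrightarrow> b < Mt \<Longrightarrow>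
      outer_sum Mr Mt r s u v $$ (a, b) = (\<Sum>k<K. Xr a k * d k * Xt b k)"
    and d: "\<And>k. k < K \<Longrightarrow> d k \<noteq> 0"
    and coer_r: "coercive Mr K Xr lr" "0 < lr"
    and coer_t: "coercive Mt K (\<lambda>b k. cnj (Xt b k)) lt" "0 < lt"
  shows "K \<le> r"
proof (rule ccontr)
  assume "\<not> K \<le> r"
  then obtain c where c: "\<And>i. i < r \<Longrightarrow> (\<Sum>k<K. (\<Sum>b<Mt. cnj (Xt b k) * cnj (v i $ b)) * c k) = 0"
      "\<exists>k<K. c k \<noteq> 0"
    using wide_system_kernel[of r K "\<lambda>i k. \<Sum>b<Mt. cnj (Xt b k) * cnj (v i $ b)"] by auto
  define y where "y b = (\<Sum>k<K. cnj (Xt b k) * c k)" for b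
  define w where "w k = (\<Sum>b<Mt. Xt b k * y b)" for k
  have cnj_y: "cnj (y b) = (\<Sum>k<K. Xt b k * cnj (c k))" for b by (simp add: y_def)
  have y_orth: "(\<Sum>b<Mt. y b * cnj (v i $ b)) = 0" if "i < r" for i
  proof -
    have "(\<Sum>b<Mt. y b * cnj (v i $ b)) = (\<Sum>b<Mt. \<Sum>k<K. cnj (Xt b k) * cnj (v i $ b) * c k)"
      by (simp add: y_def sum_distrib_left sum_distrib_right mult_ac)
    also have "\<dots> = (\<Sum>k<K. (\<Sum>b<Mt. cnj (Xt b k) * cnj (v i $ b)) * c k)"
      by (subst sum.swap) (simp add: sum_distrib_right)
    finally show ?thesis using c(1)[OF that] by simp
  qed
  have "(\<Sum>k<K. Xr a k * (d k * w k)) = 0" if a: "a < Mr" for a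
  proof -
    have "(\<Sum>k<K. Xr a k * (d k * w k)) = (\<Sum>k<K. \<Sum>b<Mt. Xr a k * d k * Xt b k * y b)"
      by (simp add: w_def sum_distrib_left mult.assoc)
    also have "\<dots> = (\<Sum>b<Mt. outer_sum Mr Mt r s u v $$ (a, b) * y b)"
      by (subst sum.swap) (simp add: eq[OF a] sum_distrib_right)
    also have "\<dots> = 0" unfolding outer_sum_mult[OF a] by (simp add: y_orth)
    finally show ?thesis .
  qed
  then have "d k * w k = 0" if "k < K" for k
    by (rule coercive_kernel[OF coer_r _ that])
  then have w0: "w k = 0" if "k < K" for k using d that by simp
  have "complex_of_real (\<Sum>b<Mt. (cmod (y b))\<^sup>2) = (\<Sum>b<Mt. y b * cnj (y b))"
    by (rule sum_mult_cnj[symmetric])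
  also have "\<dots> = (\<Sum>b<Mt. \<Sum>k<K. cnj (c k) * (Xt b k * y b))"
    by (simp add: cnj_y sum_distrib_left mult_ac)
  also have "\<dots> = (\<Sum>k<K. cnj (c k) * w k)"
    by (subst sum.swap) (simp add: w_def sum_distrib_left)
  also have "\<dots> = 0" by (simp add: w0)
  finally have "(\<Sum>b<Mt. (cmod (y b))\<^sup>2) = 0" by (simp only: of_real_eq_0_iff)
  then have "(\<Sum>k<K. cnj (Xt b k) * c k) = 0" if "b < Mt" for b
    using that by (simp add: sum_nonneg_eq_0_iff flip: y_def)
  then have "c k = 0" if "k < K" for k
    by (rule coercive_kernel[OF coer_t _ that])
  with c(2) show False by blast
qed

lemma obeys_A0_A1:
  assumes A: "A \<in> carrier_mat Mr Mt"
    and A_eq: "\<And>a b. a < Mr \<Longrightarrow> b < Mt \<Longrightarrow> A $$ (a, b) = (\<Sum>k<K. Xr a k * d k * Xt b k)"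
    and d: "\<And>k. k < K \<Longrightarrow> d k \<noteq> 0"
    and K: "1 \<le> K" and Mr: "0 < Mr" and Mt: "0 < Mt"
    and one_r: "\<And>a k. a < Mr \<Longrightarrow> k < K \<Longrightarrow> cmod (Xr a k) = 1"
    and one_t: "\<And>b k. b < Mt \<Longrightarrow> k < K \<Longrightarrow> cmod (Xt b k) = 1"
    and coer_r: "coercive Mr K Xr lr" and lr: "0 < lr" "real Mr / lr \<le> mu"
    and coer_t: "coercive Mt K (\<lambda>b k. cnj (Xt b k)) lt" and lt: "0 < lt" "real Mt / lt \<le> mu"
  shows "obeys_A0 A mu" "obeys_A1 A (sqrt (real K) * mu)"
proof -
  have dims: "dim_row A = Mr" "dim_col A = Mt" using A by auto
  have "0 < real Mr / lr" using lr Mr by simp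
  then have mu: "0 < mu" using lr(2) by linarith
  have bound_r: "real K / lr \<le> real K * mu / real Mr"
  proof -
    have "real K / lr = real K * (real Mr / lr) / real Mr" using Mr by simp
    also have "\<dots> \<le> real K * mu / real Mr" using lr by (intro divide_right_mono mult_left_mono) auto
    finally show ?thesis .
  qed
  have bound_t: "real K / lt \<le> real K * mu / real Mt"
  proof -
    have "real K / lt = real K * (real Mt / lt) / real Mt" using Mt by simp
    also have "\<dots> \<le> real K * mu / real Mt" using lt by (intro divide_right_mono mult_left_mono) auto
    finally show ?thesis .
  qed
  have svd: "orthonormal_family Mr r u" "orthonormal_family Mt r v" "K \<le> r"
    "\<And>a. a < Mr \<Longrightarrow> (\<Sum>i<r. (cmod (u i $ a))\<^sup>2) \<le> real K * mu / real Mr"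
    "\<And>b. b < Mt \<Longrightarrow> (\<Sum>i<r. (cmod (v i $ b))\<^sup>2) \<le> real K * mu / real Mt"
    if "compact_svd A r s u v" for r s u v
  proof -
    have s: "0 < s i" if "i < r" for i
      using \<open>compact_svd A r s u v\<close> that unfolding compact_svd_def by blast
    show u: "orthonormal_family Mr r u" and v: "orthonormal_family Mt r v"
      using that unfolding compact_svd_def dims by blast+
    have "A = outer_sum Mr Mt r s u v" using that unfolding compact_svd_def dims by blast
    then have A_outer: "A $$ (a, b) = outer_sum Mr Mt r s u v $$ (a, b)" for a b by simp
    have O: "outer_sum Mr Mt r s u v $$ (a, b) = (\<Sum>k<K. Xr a k * d k * Xt b k)"
      if "a < Mr" "b < Mt" for a b
      using A_eq[OF that] unfolding A_outer .
    show "K \<le> r"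
      using outer_sum_terms_ge[OF O d coer_r lr(1) coer_t lt(1)] by blast
    have ru: "u i $ a = (\<Sum>k<K. Xr a k * (d k * (\<Sum>b<Mt. Xt b k * v i $ b) / of_real (s i)))"
      if "i < r" "a < Mr" for i a
    proof -
      have "of_real (s i) * u i $ a = (\<Sum>b<Mt. \<Sum>k<K. Xr a k * d k * Xt b k * v i $ b)"
        using outer_sum_singular[OF v that, of s u] that by (simp add: O sum_distrib_right)
      also have "\<dots> = (\<Sum>k<K. Xr a k * (d k * (\<Sum>b<Mt. Xt b k * v i $ b)))"
        by (subst sum.swap) (simp add: sum_distrib_left mult_ac)
      finally have "u i $ a = (\<Sum>k<K. Xr a k * (d k * (\<Sum>b<Mt. Xt b k * v i $ b))) / of_real (s i)"
        using s[OF that(1)] by (simp add: field_simps)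
      then show ?thesis by (simp add: sum_divide_distrib)
    qed
    have rv: "v i $ b = (\<Sum>k<K. cnj (Xt b k) * (cnj (d k) * (\<Sum>a<Mr. cnj (Xr a k) * u i $ a) / of_real (s i)))"
      if "i < r" "b < Mt" for i b
    proof -
      have "of_real (s i) * v i $ b = (\<Sum>a<Mr. \<Sum>k<K. cnj (Xr a k) * cnj (d k) * cnj (Xt b k) * u i $ a)"
        using outer_sum_adjoint_singular[OF u that, of s v] that by (simp add: O sum_distrib_right)
      also have "\<dots> = (\<Sum>k<K. cnj (Xt b k) * (cnj (d k) * (\<Sum>a<Mr. cnj (Xr a k) * u i $ a)))"
        by (subst sum.swap) (simp add: sum_distrib_left mult_ac)
      finally have "v i $ b = (\<Sum>k<K. cnj (Xt b k) * (cnj (d k) * (\<Sum>a<Mr. cnj (Xr a k) * u i $ a))) / of_real (s i)"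
        using s[OF that(1)] by (simp add: field_simps)
      then show ?thesis by (simp add: sum_divide_distrib)
    qed
    show "(\<Sum>i<r. (cmod (u i $ a))\<^sup>2) \<le> real K * mu / real Mr" if "a < Mr" for a
      by (rule order.trans[OF leverage_le[OF u ru coer_r lr(1) that one_r[OF that]] bound_r])
    show "(\<Sum>i<r. (cmod (v i $ b))\<^sup>2) \<le> real K * mu / real Mt" if "b < Mt" for b
      by (rule order.trans[OF leverage_le[OF v rv coer_t lt(1) that] bound_t]) (simp_all add: one_t that)
  qed
  have coh: "coherence N (cspan N (x ` {..<r})) \<le> mu"
    if "orthonormal_family N r x" "0 < N" "K \<le> r"
      "\<And>a. a < N \<Longrightarrow> (\<Sum>i<r. (cmod (x i $ a))\<^sup>2) \<le> real K * mu / real N" for N r x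
  proof -
    have "coherence N (cspan N (x ` {..<r})) \<le> real N / real r * (real K * mu / real N)"
      by (rule coherence_orthonormal_le[OF that(1,2,4)])
    also have "\<dots> = real K / real r * mu" using that(2) by simp
    also have "\<dots> \<le> mu" using that(3) K mu by (intro mult_left_le_one_le) auto
    finally show ?thesis .
  qed
  show "obeys_A0 A mu"
    unfolding obeys_A0_def dims
  proof (intro conjI allI impI)
    show "\<exists>r s u v. compact_svd A r s u v" by (rule compact_svd_exists)
    fix r s u v assume "compact_svd A r s u v"
    note svd = svd[OF this]
    from coh[OF svd(1) Mr svd(3,4)] coh[OF svd(2) Mt svd(3,5)]
    show "max (coherence Mr (cspan Mr (u ` {..<r}))) (coherence Mt (cspan Mt (v ` {..<r}))) \<le> mu"
      by simp
  qed (rule mu)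
  show "obeys_A1 A (sqrt (real K) * mu)"
    unfolding obeys_A1_def dims
  proof (intro conjI allI impI)
    show "0 < sqrt (real K) * mu" using K mu by simp
    show "\<exists>r s u v. compact_svd A r s u v" by (rule compact_svd_exists)
    fix r s u v assume c: "compact_svd A r s u v"
    have "cmod (outer_sum Mr Mt r (\<lambda>_. 1) u v $$ (a, b))
        \<le> sqrt (real K) * mu * sqrt (real r / (real Mr * real Mt))" if ab: "a < Mr" "b < Mt" for a b
    proof -
      have "cmod (outer_sum Mr Mt r (\<lambda>_. 1) u v $$ (a, b)) = cmod (\<Sum>i<r. u i $ a * cnj (v i $ b))"
        using ab by (simp add: outer_sum_def)
      also have "\<dots> \<le> (\<Sum>i<r. \<bar>cmod (u i $ a)\<bar> * \<bar>cmod (v i $ b)\<bar>)"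
        by (rule order.trans[OF norm_sum]) (simp add: norm_mult)
      also have "\<dots> \<le> sqrt (\<Sum>i<r. (cmod (u i $ a))\<^sup>2) * sqrt (\<Sum>i<r. (cmod (v i $ b))\<^sup>2)"
        using L2_set_mult_ineq[of "\<lambda>i. cmod (u i $ a)" "\<lambda>i. cmod (v i $ b)" "{..<r}"]
        by (simp add: L2_set_def)
      also have "\<dots> \<le> sqrt (real K * mu / real Mr) * sqrt (real K * mu / real Mt)"
        using svd(4)[OF c ab(1)] svd(5)[OF c ab(2)] mu by (intro mult_mono) (auto simp: sum_nonneg)
      also have "\<dots> = sqrt ((mu * mu * real K) * (real K / (real Mr * real Mt)))"
        by (simp flip: real_sqrt_mult add: mult_ac)
      also have "\<dots> = sqrt (real K) * mu * sqrt (real K / (real Mr * real Mt))"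
        unfolding real_sqrt_mult using mu by (simp add: mult_ac)
      also have "\<dots> \<le> sqrt (real K) * mu * sqrt (real r / (real Mr * real Mt))"
        using svd(3)[OF c] mu by (intro mult_left_mono real_sqrt_le_mono divide_right_mono) auto
      finally show ?thesis .
    qed
    then show "max_entry_norm (outer_sum Mr Mt r (\<lambda>_. 1) u v)
        \<le> sqrt (real K) * mu * sqrt (real r / (real Mr * real Mt))"
      unfolding max_entry_norm_def using Mr Mt
      by (subst Max_le_iff) (auto simp: outer_sum_def intro!: bexI[of _ 0])
  qed
qed

subsection \<open>Steering matrices\<close>

lemma array_phi_conv:
  "array_phi lam pos M x y = (\<Sum>l<M. exp (\<i> * of_real (2 * pi * inner (normalized_pos lam pos l) (direction x)))
     * cnj (exp (\<i> * of_real (2 * pi * inner (normalized_pos lam pos l) (direction y)))))"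
  unfolding array_phi_def
  by (intro sum.cong refl)
    (simp add: exp_cnj inner_diff_right right_diff_distrib flip: exp_add)

lemma cmod_array_phi_le:
  assumes "(x, y) \<in> A"
  shows "cmod (array_phi lam pos M x y) \<le> sqrt (array_beta lam pos M A)"
proof -
  have "cmod (array_phi lam pos M x y) \<le> real M" for x y
    unfolding array_phi_def by (rule order.trans[OF norm_sum]) (simp only: norm_exp_i_times, simp)
  then have "bdd_above ((\<lambda>(x, y). (cmod (array_phi lam pos M x y))\<^sup>2) ` A)"
    by (intro bdd_aboveI[of _ "(real M)\<^sup>2"]) (auto intro: power_mono)
  from cSUP_upper[OF assms this]
  have "(cmod (array_phi lam pos M x y))\<^sup>2 \<le> array_beta lam pos M A"
    by (simp add: array_beta_def)
  then show ?thesis by (rule real_le_rsqrt)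
qed

lemma array_beta_nonneg:
  assumes "A \<noteq> {}"
  shows "0 \<le> array_beta lam pos M A"
proof -
  obtain x y where "(x, y) \<in> A" using assms by auto
  from cmod_array_phi_le[OF this] have "0 \<le> sqrt (array_beta lam pos M A)"
    using norm_ge_zero order.trans by blast
  then show ?thesis by simp
qed

lemma coercive_steering:
  fixes theta :: "nat \<Rightarrow> real" and lam :: real and pos :: "nat \<Rightarrow> real \<times> real"
  defines "X \<equiv> \<lambda>l k. exp (\<i> * of_real (2 * pi * inner (normalized_pos lam pos l) (direction (theta k))))"
  assumes A: "A \<noteq> {}" "\<And>i j. i < K \<Longrightarrow> j < K \<Longrightarrow> i \<noteq> j \<Longrightarrow> (theta i, theta j) \<in> A"
  shows "coercive M K X (real M - (real K - 1) * sqrt (array_beta lam pos M A))"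
    and "coercive M K (\<lambda>l k. cnj (X l k)) (real M - (real K - 1) * sqrt (array_beta lam pos M A))"
proof -
  have one: "cmod (X l k) = 1" for l k unfolding X_def by (rule norm_exp_i_times)
  have b: "0 \<le> sqrt (array_beta lam pos M A)" using array_beta_nonneg[OF A(1)] by simp
  have off: "cmod (\<Sum>l<M. X l i * cnj (X l j)) \<le> sqrt (array_beta lam pos M A)"
    if "i < K" "j < K" "i \<noteq> j" for i j
    using cmod_array_phi_le[OF A(2)[OF that], of lam pos M] by (simp only: array_phi_conv X_def)
  show "coercive M K X (real M - (real K - 1) * sqrt (array_beta lam pos M A))"
    by (rule coercive_unimodular[OF one off b])
  have "cmod (\<Sum>l<M. cnj (X l i) * cnj (cnj (X l j))) \<le> sqrt (array_beta lam pos M A)"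
    if "i < K" "j < K" "i \<noteq> j" for i j
    using off[OF that(2,1)] that(3) by (simp add: mult.commute)
  then show "coercive M K (\<lambda>l k. cnj (X l k)) (real M - (real K - 1) * sqrt (array_beta lam pos M A))"
    by (intro coercive_unimodular b) (simp_all add: one)
qed

lemma data_matrix_index:
  assumes "D \<in> carrier_mat K K" "diagonal_mat D" "a < Mr" "b < Mt"
  shows "data_matrix (Matrix.mat Mr K (\<lambda>(l, k). X l k)) D (Matrix.mat Mt K (\<lambda>(l, k). Y l k)) $$ (a, b)
       = (\<Sum>k<K. X a k * D $$ (k, k) * Y b k)"
proof -
  have "(\<Sum>j<K. X a j * D $$ (j, k)) = X a k * D $$ (k, k)" if "k < K" for k
  proof -
    have "(\<Sum>j<K. X a j * D $$ (j, k)) = (\<Sum>j<K. if j = k then X a k * D $$ (k, k) else 0)"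
      using assms that by (intro sum.cong) (auto simp: diagonal_mat_def)
    then show ?thesis using that by simp
  qed
  then show ?thesis
    using assms by (simp add: data_matrix_def scalar_prod_def atLeast0LessThan)
qed

lemma dominance_gap_pos:
  fixes b :: real
  assumes b: "0 \<le> b" "b < (real M)\<^sup>2" and K: "ereal (real K) \<le> ereal (real M) / ereal (sqrt b)"
  shows "0 < real M - (real K - 1) * sqrt b"
proof (cases "b = 0")
  case True
  then show ?thesis using b by simp
next
  case False
  then have s: "0 < sqrt b" using b by simp
  then have "real K \<le> real M / sqrt b" using K by simp
  then have "real K * sqrt b \<le> real M" using s by (simp add: pos_le_divide_eq)
  then show ?thesis using s unfolding left_diff_distrib by linarith
qed

theorem theorem6:
  fixes P :: "'w measure"
    and lam :: real
    and pos_t pos_r :: "nat \<Rightarrow> real \<times> real"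
    and M_t M_r K :: nat
    and theta :: "nat \<Rightarrow> 'w \<Rightarrow> real"
    and D :: "'w \<Rightarrow> complex Matrix.mat"
    and A :: "(real \<times> real) set"
  defines "beta_t \<equiv> array_beta lam pos_t M_t A"
    and "beta_r \<equiv> array_beta lam pos_r M_r A"
  assumes "prob_space P"
    and "lam > 0"
    and "K \<ge> 1"
    and "\<And>k. k < K \<Longrightarrow> theta k \<in> borel_measurable P"
    and "\<And>w. w \<in> space P \<Longrightarrow>
          D w \<in> carrier_mat K K \<and> diagonal_mat (D w) \<and> (\<forall>k<K. D w $$ (k, k) \<noteq> 0)"
    and "A \<noteq> {}"
    and "A \<subseteq> UNIV - {(x, y). x = y}"
    and "AE w in P. \<forall>i<K. \<forall>j<K. i \<noteq> j \<longrightarrow> theta i w \<noteq> theta j w"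
    and "AE w in P. \<forall>i<K. \<forall>j<K. i \<noteq> j \<longrightarrow> (theta i w, theta j w) \<in> A"
    and "beta_t < (real M_t)\<^sup>2"
    and "beta_r < (real M_r)\<^sup>2"
    and "ereal (real K) \<le> min (ereal (real M_t) / ereal (sqrt beta_t))
                              (ereal (real M_r) / ereal (sqrt beta_r))"
  shows "AE w in P.
    (let Delta = data_matrix
            (steering_matrix lam pos_r M_r K (\<lambda>k. theta k w))
            (D w)
            (steering_matrix lam pos_t M_t K (\<lambda>k. theta k w));
         mu0 = max (real M_t / (real M_t - (real K - 1) * sqrt beta_t))
                   (real M_r / (real M_r - (real K - 1) * sqrt beta_r));
         mu1 = max (real M_t * sqrt (real K) / (real M_t - (real K - 1) * sqrt beta_t))
                   (real M_r * sqrt (real K) / (real M_r - (real K - 1) * sqrt beta_r))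
     in obeys_A0 Delta mu0 \<and> obeys_A1 Delta mu1)"
proof -
  define lt lr where "lt = real M_t - (real K - 1) * sqrt beta_t"
    and "lr = real M_r - (real K - 1) * sqrt beta_r"
  have beta: "0 \<le> beta_t" "0 \<le> beta_r"
    unfolding beta_t_def beta_r_def using \<open>A \<noteq> {}\<close> by (simp_all add: array_beta_nonneg)
  have M: "0 < M_t" "0 < M_r"
    using beta \<open>beta_t < (real M_t)\<^sup>2\<close> \<open>beta_r < (real M_r)\<^sup>2\<close> by (auto intro: Nat.gr0I)
  have "0 < lt"
    unfolding lt_def
    by (rule dominance_gap_pos[OF beta(1) assms(12)]) (use assms(14) in \<open>simp only: min.bounded_iff\<close>)
  moreover have "0 < lr"
    unfolding lr_def
    by (rule dominance_gap_pos[OF beta(2) assms(13)]) (use assms(14) in \<open>simp only: min.bounded_iff\<close>)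
  ultimately have l: "0 < lt" "0 < lr" by simp_all
  define mu where "mu = max (real M_t / lt) (real M_r / lr)"
  have mu1: "max (real M_t * sqrt (real K) / lt) (real M_r * sqrt (real K) / lr) = sqrt (real K) * mu"
    by (simp add: mu_def max_mult_distrib_left mult.commute)
  have main: "obeys_A0 (data_matrix (steering_matrix lam pos_r M_r K (\<lambda>k. theta k w)) (D w)
            (steering_matrix lam pos_t M_t K (\<lambda>k. theta k w))) mu \<and>
        obeys_A1 (data_matrix (steering_matrix lam pos_r M_r K (\<lambda>k. theta k w)) (D w)
            (steering_matrix lam pos_t M_t K (\<lambda>k. theta k w))) (sqrt (real K) * mu)"
    if w: "w \<in> space P" and th: "\<forall>i<K. \<forall>j<K. i \<noteq> j \<longrightarrow> (theta i w, theta j w) \<in> A" for w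
  proof -
    have Dw: "D w \<in> carrier_mat K K" "diagonal_mat (D w)" "\<And>k. k < K \<Longrightarrow> D w $$ (k, k) \<noteq> 0"
      using assms(7)[OF w] by auto
    have th': "(theta i w, theta j w) \<in> A" if "i < K" "j < K" "i \<noteq> j" for i j
      using th that by blast
    note steer = coercive_steering[where theta = "\<lambda>k. theta k w", OF \<open>A \<noteq> {}\<close> th']
    let ?X = "\<lambda>pos l k. exp (\<i> * of_real (2 * pi * inner (normalized_pos lam pos l) (direction (theta k w))))"
    let ?Delta = "data_matrix (Matrix.mat M_r K (\<lambda>(l, k). ?X pos_r l k)) (D w)
      (Matrix.mat M_t K (\<lambda>(l, k). ?X pos_t l k))"
    have Delta: "?Delta \<in> carrier_mat M_r M_t" by (rule carrier_matI) (simp_all add: data_matrix_def)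
    have *: "coercive M_r K (?X pos_r) lr" "coercive M_t K (\<lambda>l k. cnj (?X pos_t l k)) lt"
      unfolding lr_def lt_def beta_r_def beta_t_def by (rule steer(1), assumption+) (rule steer(2), assumption+)
    have one: "cmod (?X pos l k) = 1" for pos l k by (rule norm_exp_i_times)
    have mu: "real M_r / lr \<le> mu" "real M_t / lt \<le> mu" by (simp_all add: mu_def)
    show ?thesis
      unfolding steering_matrix_def
      using obeys_A0_A1[OF Delta data_matrix_index[OF Dw(1,2)] Dw(3) \<open>K \<ge> 1\<close> M(2,1) one one
          *(1) l(2) mu(1) *(2) l(1) mu(2)] by blast
  qed
  show ?thesis
    unfolding Let_def lt_def[symmetric] lr_def[symmetric] mu1 mu_def[symmetric]
    by (rule AE_mp[OF assms(11)], rule AE_I2, rule impI, rule main)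
qed

end
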